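(* Let $G$ be a $1$-degenerated graph without isolated edges. Then $$\chi_{1-vsdt}(G)\le \Delta(G)+3,$$ where $\Delta(G)$ is the maximum degree of $G$.
   Context: All graphs are finite, simple and undirected. A graph $G$ is $k$-degenerated if $\delta(H)\le k$ for every subgraph $H$ of $G$, where $\delta(H)$ is the minimum degree. For a vertex $u$ of $G$, let $N\langle u\rangle = N[u]\cup\{uv : v\in N(u)\}$, where $N(u)$ and $N[u]=N(u)\cup\{u\}$ are the open and closed neighborhoods; so $N\langle u\rangle$ consists of $u$, its neighbors and its incident edges. A proper $\kappa$-total coloring of $G$ is a map $f:V(G)\cup E(G)\to\{1,\dots,\kappa\}$ such that any two adjacent vertices, any two edges sharing an endpoint, and any vertex and incident edge receive different colors. Put $C_f\langle u\rangle=\{f(x): x\in N\langle u\rangle\}$. For a graph $G$ with no isolated edges (no connected component is $K_2$), a $\kappa$-$D(1)$-VSDTC of $G$ ($1$-vertex-strongly-distinguishing total coloring) is a proper $\kappa$-total coloring $f$ such that $C_f\langle u\rangle\neq C_f\langle v\rangle$ for any two adjacent vertices $u,v$. $\chi_{1-vsdt}(G)$ is the minimum $\kappa$ for which $G$ admits a $\kappa$-$D(1)$-VSDTC. *)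

theory Defs
  imports Complex_Main "HOL-Library.Extended_Nat"
begin

record 'a ugraph =
  verts :: "'a set"
  edges :: "'a set set"

definition graph :: "'a ugraph \<Rightarrow> bool" where
  "graph G \<longleftrightarrow> finite (verts G) \<and> (\<forall>e\<in>edges G. e \<subseteq> verts G \<and> card e = 2)"

definition subgraph :: "'a ugraph \<Rightarrow> 'a ugraph \<Rightarrow> bool" where
  "subgraph H G \<longleftrightarrow> graph H \<and> verts H \<subseteq> verts G \<and> edges H \<subseteq> edges G"

definition nbhd :: "'a ugraph \<Rightarrow> 'a \<Rightarrow> 'a set" where
  "nbhd G u = {v \<in> verts G. {u, v} \<in> edges G}"

definition closed_nbhd :: "'a ugraph \<Rightarrow> 'a \<Rightarrow> 'a set" where
  "closed_nbhd G u = insert u (nbhd G u)"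

definition degree :: "'a ugraph \<Rightarrow> 'a \<Rightarrow> nat" where
  "degree G u = card (nbhd G u)"

text \<open>
  The minimum degree is meaningful only for a nonempty vertex set, so degeneracy ranges over
  nonempty subgraphs. For the maximum degree, Sup on naturals is Max, and 0 on the empty set.
\<close>

definition min_degree :: "'a ugraph \<Rightarrow> nat" where
  "min_degree G = Min (degree G ` verts G)"

definition max_degree :: "'a ugraph \<Rightarrow> nat" where
  "max_degree G = (SUP u\<in>verts G. degree G u)"

definition degenerated :: "nat \<Rightarrow> 'a ugraph \<Rightarrow> bool" where
  "degenerated k G \<longleftrightarrow> (\<forall>H. subgraph H G \<and> verts H \<noteq> {} \<longrightarrow> min_degree H \<le> k)"

definition induced_subgraph :: "'a ugraph \<Rightarrow> 'a set \<Rightarrow> 'a ugraph" where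
  "induced_subgraph G W = \<lparr>verts = verts G \<inter> W, edges = {e \<in> edges G. e \<subseteq> W}\<rparr>"

definition reachable_from :: "'a ugraph \<Rightarrow> 'a \<Rightarrow> 'a set" where
  "reachable_from G u = {v. (u, v) \<in> {(x, y). {x, y} \<in> edges G}\<^sup>*}"

definition components :: "'a ugraph \<Rightarrow> 'a ugraph set" where
  "components G = (\<lambda>u. induced_subgraph G (reachable_from G u)) ` verts G"

definition is_K2 :: "'a ugraph \<Rightarrow> bool" where
  "is_K2 G \<longleftrightarrow> (\<exists>u v. u \<noteq> v \<and> verts G = {u, v} \<and> edges G = {{u, v}})"

definition no_isolated_edges :: "'a ugraph \<Rightarrow> bool" where
  "no_isolated_edges G \<longleftrightarrow> (\<forall>C\<in>components G. \<not> is_K2 C)"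

text \<open>
  A map on the union of vertices and edges is a function on the disjoint sum: a vertex u is
  Inl u and an edge e is Inr e. Its values outside \<open>verts G <+> edges G\<close> are irrelevant.
\<close>

definition strong_nbhd :: "'a ugraph \<Rightarrow> 'a \<Rightarrow> ('a + 'a set) set" where
  "strong_nbhd G u = closed_nbhd G u <+> {{u, v} | v. v \<in> nbhd G u}"

definition proper_total_coloring :: "nat \<Rightarrow> 'a ugraph \<Rightarrow> ('a + 'a set \<Rightarrow> nat) \<Rightarrow> bool" where
  "proper_total_coloring k G f \<longleftrightarrow>
     f ` (verts G <+> edges G) \<subseteq> {1..k} \<and>
     (\<forall>u\<in>verts G. \<forall>v\<in>verts G. {u, v} \<in> edges G \<longrightarrow> f (Inl u) \<noteq> f (Inl v)) \<and>
     (\<forall>e\<in>edges G. \<forall>e'\<in>edges G. e \<noteq> e' \<and> e \<inter> e' \<noteq> {} \<longrightarrow> f (Inr e) \<noteq> f (Inr e')) \<and>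
     (\<forall>u\<in>verts G. \<forall>e\<in>edges G. u \<in> e \<longrightarrow> f (Inl u) \<noteq> f (Inr e))"

definition color_set :: "'a ugraph \<Rightarrow> ('a + 'a set \<Rightarrow> nat) \<Rightarrow> 'a \<Rightarrow> nat set" where
  "color_set G f u = f ` strong_nbhd G u"

definition vsdtc :: "nat \<Rightarrow> 'a ugraph \<Rightarrow> ('a + 'a set \<Rightarrow> nat) \<Rightarrow> bool" where
  "vsdtc k G f \<longleftrightarrow> proper_total_coloring k G f \<and>
     (\<forall>u\<in>verts G. \<forall>v\<in>verts G. {u, v} \<in> edges G \<longrightarrow> color_set G f u \<noteq> color_set G f v)"

text \<open>
  The minimum is taken in \<^typ>\<open>enat\<close>, so that it is infinite when no such coloring exists;
  a finite upper bound therefore includes the existence of a coloring.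
\<close>

definition chi_vsdt :: "'a ugraph \<Rightarrow> enat" where
  "chi_vsdt G = Inf {enat k | k. \<exists>f. vsdtc k G f}"

end

theory Submission
  imports Defs
begin

text \<open>
  Color the vertices of the forest properly with two colors and its edges with the other
  \<open>\<Delta> + 1\<close> colors. Both vertex colors occur in every strong neighborhood of a
  non-isolated vertex, so it suffices that adjacent vertices see different sets of edge colors.
  Such an edge coloring is found greedily, along an ordering in which each vertex \<open>v\<close> has at most
  one earlier neighbor \<open>p\<close>: handling a vertex colors all its incident edges, so only \<open>vp\<close> is
  colored when \<open>v\<close> is reached. If \<open>v\<close> has degree \<open>d \<ge> 2\<close>, its \<open>d - 1\<close> other colors can be
  any subset of \<open>\<Delta> > d - 1\<close> remaining colors, and one of these subsets makes the color set
  of \<open>v\<close> different from that of \<open>p\<close>. If \<open>d = 1\<close>, then \<open>p\<close> has larger degree because \<open>vp\<close> is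
  not an isolated edge.
\<close>

section \<open>Incident edges and degrees\<close>

definition inc :: "'a ugraph \<Rightarrow> 'a \<Rightarrow> 'a set set" where
  "inc G u = {e \<in> edges G. u \<in> e}"

lemma finite_edges:
  assumes "graph G"
  shows "finite (edges G)"
proof (rule finite_subset)
  show "edges G \<subseteq> Pow (verts G)" "finite (Pow (verts G))"
    using assms by (auto simp: graph_def)
qed

lemma finite_inc: "graph G \<Longrightarrow> finite (inc G u)"
  using finite_edges[of G] by (simp add: inc_def)

lemma edge_at_cases:
  assumes "graph G" "e \<in> edges G" "u \<in> e"
  obtains v where "v \<noteq> u" "v \<in> verts G" "e = {u, v}"
proof -
  have e: "card e = 2" "e \<subseteq> verts G"
    using assms by (auto simp: graph_def)
  then obtain x y where "e = {x, y}" "x \<noteq> y"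
    by (auto simp: card_2_iff)
  with e(2) assms(3) that show ?thesis
    by (metis insertE insert_commute insert_subset singletonD)
qed

lemma edge_ends:
  assumes "graph G" "{u, v} \<in> edges G"
  shows "u \<noteq> v" "u \<in> verts G" "v \<in> verts G"
proof -
  have "card {u, v} = 2" "{u, v} \<subseteq> verts G"
    using assms unfolding graph_def by blast+
  then show "u \<noteq> v" "u \<in> verts G" "v \<in> verts G"
    by auto
qed

lemma inc_conv_nbhd:
  assumes "graph G"
  shows "inc G u = (\<lambda>v. {u, v}) ` nbhd G u"
  using assms by (fastforce simp: inc_def nbhd_def elim: edge_at_cases)

lemma card_inc: "graph G \<Longrightarrow> card (inc G u) = degree G u"
  unfolding inc_conv_nbhd degree_def
  by (rule card_image) (auto simp: inj_on_def doubleton_eq_iff)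

lemma degree_le_max_degree:
  assumes "graph G" "u \<in> verts G"
  shows "degree G u \<le> max_degree G"
  unfolding max_degree_def
  using assms by (intro cSUP_upper) (auto simp: graph_def intro: bdd_above_finite)

section \<open>Degeneracy as a vertex ordering, and two-coloring the vertices\<close>

text \<open>A vertex of minimum degree in the subgraph induced on \<open>W\<close> has at most
  \<open>k\<close> neighbors in \<open>W\<close>. Removing such vertices one by one and reading the
  order backwards builds up \<open>W\<close> as the induction requires.\<close>

lemma degenerated_induct [consumes 3, case_names empty insert]:
  assumes G: "graph G" and deg: "degenerated k G" and "W \<subseteq> verts G"
    and empty: "P {}"
    and step: "\<And>W v. W \<subseteq> verts G \<Longrightarrow> v \<in> verts G \<Longrightarrow> v \<notin> W \<Longrightarrow>
      card (nbhd G v \<inter> W) \<le> k \<Longrightarrow> P W \<Longrightarrow> P (insert v W)"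
  shows "P W"
  using \<open>W \<subseteq> verts G\<close>
proof (induction "card W" arbitrary: W)
  case 0
  then have "W = {}"
    using G finite_subset by (fastforce simp: graph_def)
  with empty show ?case by simp
next
  case (Suc n)
  have fin: "finite W" and ne: "W \<noteq> {}"
    using Suc by (auto intro: card_ge_0_finite)
  let ?H = "induced_subgraph G W"
  have H: "verts ?H = W"
    using Suc.prems by (auto simp: induced_subgraph_def)
  have "subgraph ?H G"
    using G by (auto simp: subgraph_def graph_def induced_subgraph_def)
  with deg ne H have "min_degree ?H \<le> k"
    by (simp add: degenerated_def)
  moreover have "min_degree ?H \<in> degree ?H ` W"
    unfolding min_degree_def H using fin ne by (intro Min_in) auto
  ultimately obtain v where v: "v \<in> W" "degree ?H v \<le> k"
    by auto
  have "nbhd ?H v = nbhd G v \<inter> W"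
    using v Suc.prems by (auto simp: nbhd_def induced_subgraph_def)
  moreover have "nbhd G v \<inter> (W - {v}) \<subseteq> nbhd G v \<inter> W" "finite (nbhd G v \<inter> W)"
    using fin by auto
  ultimately have c: "card (nbhd G v \<inter> (W - {v})) \<le> k"
    using v(2) card_mono[of "nbhd G v \<inter> W" "nbhd G v \<inter> (W - {v})"] unfolding degree_def by simp
  have "P (W - {v})"
    using Suc v fin by (intro Suc.hyps) auto
  with c have "P (insert v (W - {v}))"
    using Suc.prems v by (intro step) auto
  with v show ?case
    by (simp add: insert_absorb)
qed

lemma card_le_1_cases:
  assumes "finite A" "card A \<le> 1"
  obtains "A = {}" | p where "A = {p}"
  using assms by (metis card_0_eq card_1_singletonE le_neq_implies_less less_one)

lemma two_coloring:
  assumes "graph G" "degenerated 1 G" and "W \<subseteq> verts G"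
  shows "\<exists>h :: 'a \<Rightarrow> nat. range h \<subseteq> {1, 2} \<and>
    (\<forall>u\<in>W. \<forall>v\<in>W. {u, v} \<in> edges G \<longrightarrow> h u \<noteq> h v)"
  using assms
proof (induction rule: degenerated_induct)
  case empty
  show ?case by (intro exI[of _ "\<lambda>_. 1"]) auto
next
  case (insert W v)
  obtain h :: "'a \<Rightarrow> nat" where h: "range h \<subseteq> {1, 2}"
    "\<forall>u\<in>W. \<forall>v\<in>W. {u, v} \<in> edges G \<longrightarrow> h u \<noteq> h v"
    using insert by blast
  have "finite (nbhd G v \<inter> W)"
    using assms(1) by (auto simp: graph_def nbhd_def)
  \<comment> \<open>If \<open>v\<close> has no earlier neighbor, \<open>p\<close> is arbitrary, so a
    single recoloring covers both cases.\<close>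
  then obtain p where p: "nbhd G v \<inter> W \<subseteq> {p}"
    using insert.hyps by (elim card_le_1_cases) auto
  have only: "u = p" if "u \<in> W" "{v, u} \<in> edges G" for u
    using that p edge_ends(3)[OF assms(1) that(2)] by (auto simp: nbhd_def)
  \<comment> \<open>The map sending \<open>x\<close> to \<open>3 - x\<close> swaps the colors 1 and
    2.\<close>
  have pr: "3 - h u \<noteq> h u" "3 - h u \<in> {1, 2}" for u
    using h(1) by (auto dest!: range_subsetD[of h _ u])
  have "{v, v} \<notin> edges G"
    using edge_ends(1)[OF assms(1), of v v] by auto
  then have "\<forall>x\<in>insert v W. \<forall>y\<in>insert v W. {x, y} \<in> edges G \<longrightarrow>
      (h(v := 3 - h p)) x \<noteq> (h(v := 3 - h p)) y"
    using h(2) only pr(1)[of p] \<open>v \<notin> W\<close> by (auto simp: insert_commute)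
  moreover have "range (h(v := 3 - h p)) \<subseteq> {1, 2}"
    using h(1) pr(2)[of p] by auto
  ultimately show ?case by blast
qed

section \<open>Edge colorings that distinguish adjacent vertices\<close>

text \<open>The bounds on \<open>n\<close> leave an element inside and an element outside any
  \<open>n\<close>-subset; exchanging them yields a second \<open>n\<close>-subset, and
  \<open>T\<close> can equal at most one of the two.\<close>

lemma subset_card_avoiding:
  assumes "finite A" "0 < n" "n < card A"
  obtains B where "B \<subseteq> A" "card B = n" "B \<noteq> T"
proof -
  obtain B where B: "B \<subseteq> A" "card B = n"
    using assms obtain_subset_with_card_n[of n A] by auto
  then obtain x where x: "x \<in> B"
    using assms by fastforce
  obtain y where y: "y \<in> A" "y \<notin> B"
    using assms B by (metis less_irrefl subset_antisym subsetI)
  let ?B = "insert y (B - {x})"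
  have fB: "finite B"
    using B assms finite_subset by blast
  have "card ?B = n"
    using fB x y B assms(2) by (simp add: card_insert_if)
  moreover have "?B \<subseteq> A" "?B \<noteq> B"
    using B y by auto
  ultimately show ?thesis
    using B that by metis
qed

text \<open>Each endpoint is the other's only neighbor, so no walk from \<open>u\<close> leaves
  \<open>{u, v}\<close> and the component of \<open>u\<close> is a single edge.\<close>

lemma adjacent_leaves_K2:
  assumes G: "graph G" and e: "{u, v} \<in> edges G"
    and "degree G u = 1" "degree G v = 1"
  shows "\<not> no_isolated_edges G"
proof -
  have uv: "u \<noteq> v" "u \<in> verts G" "v \<in> verts G"
    using edge_ends[OF G e] by auto
  have nb: "v \<in> nbhd G u" "u \<in> nbhd G v"
    using e uv by (auto simp: nbhd_def insert_commute)
  then have N: "nbhd G u = {v}" "nbhd G v = {u}"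
    using assms(3,4) unfolding degree_def by (metis card_1_singletonE singletonD)+
  have adj: "y = v" if "{u, y} \<in> edges G" for y
    using that N(1) edge_ends[OF G that] by (auto simp: nbhd_def)
  have adj': "y = u" if "{v, y} \<in> edges G" for y
    using that N(2) edge_ends[OF G that] by (auto simp: nbhd_def)
  let ?R = "{(x, y). {x, y} \<in> edges G}"
  have "y \<in> {u, v}" if "(u, y) \<in> ?R\<^sup>*" for y
    using that by (induction rule: rtrancl_induct) (auto dest: adj adj')
  moreover have "(u, v) \<in> ?R\<^sup>*"
    using e by auto
  ultimately have R: "reachable_from G u = {u, v}"
    unfolding reachable_from_def by auto
  have "{e \<in> edges G. e \<subseteq> {u, v}} = {{u, v}}"
  proof (intro equalityI subsetI)
    fix e' assume "e' \<in> {e \<in> edges G. e \<subseteq> {u, v}}"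
    then have "e' \<subseteq> {u, v}" "card e' = card {u, v}"
      using G uv(1) by (auto simp: graph_def)
    then show "e' \<in> {{u, v}}"
      by (simp add: card_subset_eq)
  qed (use e in auto)
  then have "is_K2 (induced_subgraph G (reachable_from G u))"
    unfolding R is_K2_def induced_subgraph_def using uv by auto
  then show ?thesis
    using uv by (auto simp: no_isolated_edges_def components_def)
qed

text \<open>A partial coloring during the greedy process: \<open>W\<close> holds the vertices
  already handled. All edges at such a vertex count as colored, including those leaving
  \<open>W\<close>, so its color set is final. Injectivity on \<open>inc G u\<close> is properness
  of the edge coloring at \<open>u\<close>.\<close>

definition distinguishing_on :: "'a set \<Rightarrow> 'a ugraph \<Rightarrow> nat set \<Rightarrow> ('a set \<Rightarrow> nat) \<Rightarrow> bool" where
  "distinguishing_on W G C g \<longleftrightarrow>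
    (\<forall>u\<in>W. inj_on g (inc G u) \<and> g ` inc G u \<subseteq> C) \<and>
    (\<forall>u\<in>W. \<forall>v\<in>W. {u, v} \<in> edges G \<longrightarrow> g ` inc G u \<noteq> g ` inc G v)"

lemma distinguishing_edge_coloring:
  fixes C :: "nat set"
  assumes G: "graph G" and "degenerated 1 G" and "W \<subseteq> verts G"
    and K2: "no_isolated_edges G"
    and C: "finite C" "card C = max_degree G + 1"
  shows "\<exists>g. distinguishing_on W G C g"
  using assms(1-3)
proof (induction rule: degenerated_induct)
  case empty
  show ?case by (simp add: distinguishing_on_def)
next
  case (insert W v)
  obtain g where g: "distinguishing_on W G C g"
    using insert.IH by auto
  have inj: "\<And>u. u \<in> W \<Longrightarrow> inj_on g (inc G u)"
    and ran: "\<And>u. u \<in> W \<Longrightarrow> g ` inc G u \<subseteq> C"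
    and dist: "\<And>u w. u \<in> W \<Longrightarrow> w \<in> W \<Longrightarrow> {u, w} \<in> edges G \<Longrightarrow> g ` inc G u \<noteq> g ` inc G w"
    using g by (simp_all add: distinguishing_on_def)
  have fin: "finite (inc G v)" and le: "card (inc G v) \<le> max_degree G"
    using finite_inc[OF G] card_inc[OF G] degree_le_max_degree[OF G] insert by auto
  have noloop: "{v, v} \<notin> edges G"
    using edge_ends(1)[OF G, of v v] by auto
  \<comment> \<open>If the new coloring agrees with \<open>g\<close> on all edges at earlier
    vertices, their color sets do not change, so only \<open>v\<close> itself and its earlier
    neighbors need checking.\<close>
  have suff: ?case
    if inj': "inj_on g' (inc G v)" and ran': "g' ` inc G v \<subseteq> C"
      and old: "\<And>u e. u \<in> W \<Longrightarrow> e \<in> inc G u \<Longrightarrow> g' e = g e"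
      and new: "\<And>u. u \<in> W \<Longrightarrow> {v, u} \<in> edges G \<Longrightarrow> g' ` inc G v \<noteq> g ` inc G u"
    for g'
    unfolding distinguishing_on_def
  proof (intro exI[of _ g'] conjI ballI impI)
    have im: "g' ` inc G u = g ` inc G u" if "u \<in> W" for u
      using old[OF that] by (rule image_cong[OF refl])
    fix u assume u: "u \<in> insert v W"
    show "inj_on g' (inc G u)"
      using u inj' inj inj_on_cong[of "inc G u" g' g] old by blast
    show "g' ` inc G u \<subseteq> C"
      using u ran' ran im by (metis insertE)
    fix w assume w: "w \<in> insert v W" "{u, w} \<in> edges G"
    then have w': "{w, u} \<in> edges G"
      by (simp add: insert_commute)
    consider "u = v" "w \<in> W" | "u \<in> W" "w = v" | "u \<in> W" "w \<in> W"
      using u w noloop by auto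
    then show "g' ` inc G u \<noteq> g' ` inc G w"
    proof cases
      case 1
      with w new[of w] im[of w] show ?thesis by simp
    next
      case 2
      with w' new[of u] im[of u] show ?thesis by (simp add: eq_commute)
    next
      case 3
      with w dist[of u w] im show ?thesis by simp
    qed
  qed
  have "finite (nbhd G v \<inter> W)"
    using G by (auto simp: graph_def nbhd_def)
  moreover have "card (nbhd G v \<inter> W) \<le> 1"
    using insert by simp
  ultimately show ?case
  proof (cases rule: card_le_1_cases)
    case 1
    then have iso: "{v, u} \<notin> edges G" if "u \<in> W" for u
      using that insert.hyps(1) by (auto simp: nbhd_def)
    \<comment> \<open>No edge at \<open>v\<close> is colored yet and there is no earlier neighbor to
      be distinguished from, so any injection into \<open>C\<close> will do.\<close>
    obtain b where b: "inj_on b (inc G v)" "b ` inc G v \<subseteq> C"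
      using card_le_inj[OF fin C(1)] le C(2) by auto
    have disj: "e \<notin> inc G v" if "u \<in> W" "e \<in> inc G u" for u e
    proof
      assume "e \<in> inc G v"
      with that have "e = {v, u}"
        using \<open>v \<notin> W\<close> by (fastforce simp: inc_def elim!: edge_at_cases[OF G, of e u])
      with that iso show False
        by (auto simp: inc_def)
    qed
    show ?thesis
    proof (rule suff[of "\<lambda>e. if e \<in> inc G v then b e else g e"])
      show "inj_on (\<lambda>e. if e \<in> inc G v then b e else g e) (inc G v)"
        using b(1) by (simp add: inj_on_def)
      show "(\<lambda>e. if e \<in> inc G v then b e else g e) ` inc G v \<subseteq> C"
        using b(2) by auto
    qed (use disj iso in auto)
  next
    case (2 p)
    let ?e = "{v, p}"
    have p: "p \<in> W" "?e \<in> edges G" "v \<noteq> p"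
      using 2 \<open>v \<notin> W\<close> by (auto simp: nbhd_def)
    have only: "u = p" if "u \<in> W" "{v, u} \<in> edges G" for u
      using that 2 insert.hyps(1) by (auto simp: nbhd_def)
    define F where "F = inc G v - {?e}"
    have ev: "?e \<in> inc G v" "?e \<in> inc G p"
      using p by (auto simp: inc_def)
    have incv: "inc G v = insert ?e F" "?e \<notin> F" "finite F"
      using ev fin by (auto simp: F_def)
    have cF: "card F + 1 = card (inc G v)"
      using incv by simp
    let ?c = "g ?e"
    have cC: "?c \<in> C"
      using ran[OF p(1)] ev by auto
    \<comment> \<open>\<open>B\<close> collects the colors for the edges in \<open>F\<close>, those
      at \<open>v\<close> still uncolored; together with the fixed color \<open>?c\<close> they must
      form a set different from the one at \<open>p\<close>.\<close>
    obtain B where B: "B \<subseteq> C - {?c}" "card B = card F" "insert ?c B \<noteq> g ` inc G p"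
    proof (cases "F = {}")
      case True
      \<comment> \<open>Here \<open>B\<close> must be empty and \<open>v\<close> is a leaf. Its
        neighbor \<open>p\<close> is not a leaf, so the color set of \<open>p\<close> is not a
        singleton.\<close>
      have "degree G v = 1"
        using True cF card_inc[OF G] by auto
      then have "degree G p \<noteq> 1"
        using adjacent_leaves_K2[OF G p(2)] K2 by auto
      then have "card (g ` inc G p) \<noteq> 1"
        using card_image[OF inj[OF p(1)]] card_inc[OF G] by simp
      then have "{?c} \<noteq> g ` inc G p"
        by (metis is_singletonI is_singleton_altdef)
      then show ?thesis
        using True by (intro that[of "{}"]) auto
    next
      case False
      \<comment> \<open>\<open>card F + 1\<close> is the degree of \<open>v\<close>, hence at most
        the maximum degree, which is exactly \<open>card (C - {?c})\<close>; this makes the second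
        inequality strict.\<close>
      then have "0 < card F" "card F < card (C - {?c})"
        using incv(3) cF le C cC by (auto simp: card_gt_0_iff)
      \<comment> \<open>As \<open>?c\<close> is not in \<open>B\<close>, the set
        \<open>insert ?c B\<close> can equal the color set of \<open>p\<close> only if
        \<open>B\<close> is that set without \<open>?c\<close>, so this is the one set to
        avoid.\<close>
      then obtain B where B: "B \<subseteq> C - {?c}" "card B = card F" "B \<noteq> g ` inc G p - {?c}"
        using subset_card_avoiding[of "C - {?c}"] C(1) by (metis finite_Diff)
      then have "insert ?c B \<noteq> g ` inc G p"
        by auto
      with B show ?thesis by (intro that)
    qed
    have "finite B"
      using B(1) C(1) by (meson finite_Diff finite_subset)
    then obtain b where b: "bij_betw b F B"
      using finite_same_card_bij[OF incv(3)] B(2) by metis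
    define g' where "g' = (\<lambda>e. if e \<in> F then b e else g e)"
    have bF: "b ` F = B"
      using b by (simp add: bij_betw_def)
    have g'F: "g' ` F = B" and g'e: "g' ?e = ?c"
      using bF incv(2) by (auto simp: g'_def)
    then have im: "g' ` inc G v = insert ?c B"
      using incv(1) by simp
    have "inj_on g' F"
      using b by (simp add: g'_def bij_betw_def inj_on_def)
    then have inj': "inj_on g' (inc G v)"
      unfolding incv(1) using g'F g'e B(1) incv(2) by auto
    \<comment> \<open>An edge of \<open>F\<close> at an earlier vertex \<open>u\<close> would be
      \<open>{v, u}\<close>, forcing \<open>u = p\<close>; but \<open>{v, p}\<close> was left out of
      \<open>F\<close>.\<close>
    have old: "g' e = g e" if "u \<in> W" "e \<in> inc G u" for u e
    proof -
      have "e \<notin> F"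
      proof
        assume "e \<in> F"
        then have e: "e \<in> edges G" "v \<in> e" "e \<noteq> ?e" "u \<in> e"
          using that by (auto simp: F_def inc_def)
        then have "e = {v, u}"
          using \<open>v \<notin> W\<close> that by (auto elim!: edge_at_cases[OF G, of e v])
        with e only that show False by auto
      qed
      then show ?thesis by (simp add: g'_def)
    qed
    show ?thesis
      using B cC im only by (intro suff[OF inj' _ old]) auto
  qed
qed

section \<open>Combining the vertex and edge colorings into a total coloring\<close>

theorem corollary1p8:
  fixes G :: "'a ugraph"
  assumes "graph G"
    and "degenerated 1 G"
    and "no_isolated_edges G"
  shows "chi_vsdt G \<le> enat (max_degree G + 3)"
proof -
  \<comment> \<open>The colors 1 and 2 are reserved for vertices, which leaves
    \<open>max_degree G + 1\<close> for edges and rules out conflicts between a vertex and an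
    edge.\<close>
  let ?C = "{3..max_degree G + 3}"
  obtain h :: "'a \<Rightarrow> nat" where h: "range h \<subseteq> {1, 2}"
    "\<And>u v. u \<in> verts G \<Longrightarrow> v \<in> verts G \<Longrightarrow> {u, v} \<in> edges G \<Longrightarrow> h u \<noteq> h v"
    using two_coloring[OF assms(1,2) subset_refl] by blast
  have "card ?C = max_degree G + 1" by simp
  then obtain g where g: "distinguishing_on (verts G) G ?C g"
    using distinguishing_edge_coloring[OF assms(1,2) subset_refl assms(3) finite_atLeastAtMost]
    by metis
  have inj: "\<And>u. u \<in> verts G \<Longrightarrow> inj_on g (inc G u)"
    and ran: "\<And>u. u \<in> verts G \<Longrightarrow> g ` inc G u \<subseteq> ?C"
    and dist: "\<And>u v. u \<in> verts G \<Longrightarrow> v \<in> verts G \<Longrightarrow> {u, v} \<in> edges G \<Longrightarrow>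
      g ` inc G u \<noteq> g ` inc G v"
    using g by (simp_all add: distinguishing_on_def)
  define f where "f = case_sum h g"
  have hC: "h u \<in> {1, 2}" for u
    using h(1) by auto
  have gC: "g e \<in> ?C" if "e \<in> edges G" for e
  proof -
    have "card e = 2" "e \<subseteq> verts G"
      using that assms(1) by (auto simp: graph_def)
    then obtain u where "u \<in> e" "u \<in> verts G"
      by (metis card.empty ex_in_conv subsetD zero_neq_numeral)
    with that ran[of u] show ?thesis
      by (auto simp: inc_def)
  qed
  have "proper_total_coloring (max_degree G + 3) G f"
    unfolding proper_total_coloring_def
  proof (intro conjI ballI impI)
    have "f x \<in> {1..max_degree G + 3}" if "x \<in> verts G <+> edges G" for x
      using that
    proof (elim PlusE)
      fix u assume "x = Inl u"
      then show ?thesis using hC[of u] by (auto simp: f_def)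
    next
      fix e assume "e \<in> edges G" "x = Inr e"
      then show ?thesis using gC[of e] by (auto simp: f_def)
    qed
    then show "f ` (verts G <+> edges G) \<subseteq> {1..max_degree G + 3}" by blast
  next
    fix e e' assume e: "e \<in> edges G" "e' \<in> edges G" "e \<noteq> e' \<and> e \<inter> e' \<noteq> {}"
    then obtain u where u: "u \<in> e" "u \<in> e'" by auto
    then have "u \<in> verts G"
      using e assms(1) by (auto simp: graph_def)
    with e u inj[of u] show "f (Inr e) \<noteq> f (Inr e')"
      by (auto simp: f_def inc_def inj_on_def)
  next
    fix u e assume "e \<in> edges G"
    then show "f (Inl u) \<noteq> f (Inr e)"
      using gC[of e] hC[of u] by (auto simp: f_def)
  qed (use h(2) in \<open>auto simp: f_def\<close>)
  \<comment> \<open>Intersecting with \<open>?C\<close> discards the vertex colors, so the edge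
    colors at a vertex can be recovered from its color set; adjacent vertices with different edge
    colors thus have different color sets.\<close>
  moreover have "color_set G f u \<inter> ?C = g ` inc G u" if "u \<in> verts G" for u
  proof -
    have "{{u, v} | v. v \<in> nbhd G u} = inc G u"
      unfolding inc_conv_nbhd[OF assms(1)] by auto
    then have "color_set G f u = h ` closed_nbhd G u \<union> g ` inc G u"
      by (simp add: color_set_def strong_nbhd_def f_def Plus_def image_Un image_image)
    moreover have "h ` closed_nbhd G u \<inter> ?C = {}"
    proof -
      have "h x \<notin> ?C" for x
        using hC[of x] by auto
      then show ?thesis by blast
    qed
    ultimately show ?thesis
      using ran[OF that] by blast
  qed
  ultimately have "vsdtc (max_degree G + 3) G f"
    unfolding vsdtc_def using dist by metis
  then show ?thesis
    unfolding chi_vsdt_def by (intro Inf_lower) blast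
qed

end
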